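(* Let $k$ be a field, let $R$ be a $k$-algebra of finite type which is an integral domain, and let $K=\mathrm{Frac}(R)$ be its field of fractions. Let $K'$ be an extension of $k$ which is contained in $K$ (i.e. $k\subset K'\subset K$ are fields). Then there exists a finitely generated sub-$k$-algebra $R'$ of $K'$ containing $R\cap K'$ such that $\mathrm{Frac}(R')=\mathrm{Frac}(R\cap K')$.
   Context: $\mathrm{Frac}(A)$ denotes the field of fractions of an integral domain $A$; the fields of fractions of subrings of $K$ are regarded as subfields of $K$. *)

theory Defs
  imports "HOL-Algebra.Algebra"
begin

text \<open>
  Everything lives inside a fixed ambient field \<open>K\<close>. An algebra over a subfield \<open>k\<close> of \<open>K\<close>
  is a subring of \<open>K\<close> containing \<open>k\<close>: a nonzero algebra over a field contains (a copy of) that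
  field. The library's \<open>subalgebra\<close> is not used, since it denotes a mere subspace, not closed
  under multiplication.
\<close>

definition sub_k_algebra :: "'a set \<Rightarrow> 'a set \<Rightarrow> ('a, 'b) ring_scheme \<Rightarrow> bool" where
  "sub_k_algebra k A K \<longleftrightarrow> subring A K \<and> k \<subseteq> A"

definition finite_type :: "'a set \<Rightarrow> 'a set \<Rightarrow> ('a, 'b) ring_scheme \<Rightarrow> bool" where
  "finite_type k A K \<longleftrightarrow>
     sub_k_algebra k A K \<and> (\<exists>S. finite S \<and> S \<subseteq> A \<and> A = generate_ring K (k \<union> S))"

definition Frac :: "('a, 'b) ring_scheme \<Rightarrow> 'a set \<Rightarrow> 'a set" where
  "Frac K A = {a \<otimes>\<^bsub>K\<^esub> inv\<^bsub>K\<^esub> b | a b. a \<in> A \<and> b \<in> A \<and> b \<noteq> \<zero>\<^bsub>K\<^esub>}"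

lemma (in field) Frac_eq_generate_field:
  assumes A: "subring A R"
  shows "Frac R A = generate_field R A"
proof
  note sub = subringE[OF A]
  have AR: "x \<in> carrier R" if "x \<in> A" for x using sub(1) that by blast
  have iv: "inv b \<in> carrier R" "b \<otimes> inv b = \<one>" if "b \<in> A" "b \<noteq> \<zero>" for b
    using that AR field_Units by auto
  have iv0: "inv b \<noteq> \<zero>" if "b \<in> A" "b \<noteq> \<zero>" for b
    using iv[OF that] AR[OF that(1)] by (metis r_null zero_not_one)
  have im: "inv (b \<otimes> d) = inv b \<otimes> inv d" if "b \<in> A" "b \<noteq> \<zero>" "d \<in> A" "d \<noteq> \<zero>" for b d
  proof (rule comm_inv_char)
    have "b \<otimes> d \<otimes> (inv b \<otimes> inv d) = (b \<otimes> inv b) \<otimes> (d \<otimes> inv d)"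
      using that AR iv(1) by (simp add: m_ac)
    then show "b \<otimes> d \<otimes> (inv b \<otimes> inv d) = \<one>" using that iv by simp
  qed (use that AR iv in auto)
  have nz: "b \<otimes> d \<noteq> \<zero>" if "b \<in> A" "b \<noteq> \<zero>" "d \<in> A" "d \<noteq> \<zero>" for b d
    using integral[of b d] AR that by auto
  show "Frac R A \<subseteq> generate_field R A"
    unfolding Frac_def by (auto intro!: generate_field.eng_mult generate_field.m_inv
        intro: generate_field.incl)
  show "generate_field R A \<subseteq> Frac R A"
  proof
    fix x assume "x \<in> generate_field R A"
    then show "x \<in> Frac R A"
    proof (induction rule: generate_field.induct)
      case one
      have "\<one> = \<one> \<otimes> inv \<one>" by simp
      then show ?case unfolding Frac_def using sub(3) one_not_zero by blast
    next
      case (incl h)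
      have "h = h \<otimes> inv \<one>" using AR incl by simp
      then show ?case unfolding Frac_def using sub(3) one_not_zero incl by blast
    next
      case (a_inv h)
      then obtain a b where h: "h = a \<otimes> inv b" "a \<in> A" "b \<in> A" "b \<noteq> \<zero>"
        unfolding Frac_def by blast
      have "\<ominus> h = (\<ominus> a) \<otimes> inv b" using h AR iv by (simp add: l_minus)
      then show ?case unfolding Frac_def using h sub(5) by blast
    next
      case (m_inv h)
      then obtain a b where h: "h = a \<otimes> inv b" "a \<in> A" "b \<in> A" "b \<noteq> \<zero>"
        unfolding Frac_def by blast
      have a0: "a \<noteq> \<zero>" using m_inv(2) h iv by auto
      have "h \<otimes> (b \<otimes> inv a) = (a \<otimes> inv a) \<otimes> (b \<otimes> inv b)"
        using h AR iv(1) a0 by (simp add: m_ac)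
      also have "\<dots> = \<one>" using iv a0 h by simp
      finally have "inv h = b \<otimes> inv a"
        using h AR iv a0 by (intro comm_inv_char) auto
      then show ?case unfolding Frac_def using h a0 by blast
    next
      case (eng_add x y)
      then obtain a b c d where h: "x = a \<otimes> inv b" "a \<in> A" "b \<in> A" "b \<noteq> \<zero>"
        "y = c \<otimes> inv d" "c \<in> A" "d \<in> A" "d \<noteq> \<zero>" unfolding Frac_def by blast
      have bd: "b \<otimes> d \<in> A" "b \<otimes> d \<noteq> \<zero>"
        using h(3,4,7,8) by (simp_all add: sub(6) nz)
      have "inv (b \<otimes> d) = inv b \<otimes> inv d"
        using h im by blast
      then have "(a \<otimes> d \<oplus> c \<otimes> b) \<otimes> inv (b \<otimes> d) =
          a \<otimes> d \<otimes> (inv b \<otimes> inv d) \<oplus> c \<otimes> b \<otimes> (inv b \<otimes> inv d)"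
        using h(2-4,6-8) AR iv(1) by (simp add: l_distr)
      also have "\<dots> = a \<otimes> inv b \<otimes> (d \<otimes> inv d) \<oplus> c \<otimes> inv d \<otimes> (b \<otimes> inv b)"
        using h(2-4,6-8) AR iv(1) by (simp add: m_ac)
      finally have "x \<oplus> y = (a \<otimes> d \<oplus> c \<otimes> b) \<otimes> inv (b \<otimes> d)" using h AR iv by simp
      moreover have "a \<otimes> d \<oplus> c \<otimes> b \<in> A" using h(2,3,6,7) sub(6,7) by blast
      ultimately show ?case unfolding Frac_def using bd by blast
    next
      case (eng_mult x y)
      then obtain a b c d where h: "x = a \<otimes> inv b" "a \<in> A" "b \<in> A" "b \<noteq> \<zero>"
        "y = c \<otimes> inv d" "c \<in> A" "d \<in> A" "d \<noteq> \<zero>" unfolding Frac_def by blast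
      have bd: "b \<otimes> d \<in> A" "b \<otimes> d \<noteq> \<zero>"
        using h(3,4,7,8) by (simp_all add: sub(6) nz)
      have "inv (b \<otimes> d) = inv b \<otimes> inv d"
        using h im by blast
      then have "x \<otimes> y = (a \<otimes> c) \<otimes> inv (b \<otimes> d)" using h AR iv(1) by (simp add: m_ac)
      moreover have "a \<otimes> c \<in> A" using h(2,6) sub(6) by blast
      ultimately show ?case unfolding Frac_def using bd by blast
    qed
  qed
qed

end

theory Submission
  imports Defs
begin

text \<open>
  Put \<open>L = Frac(R \<inter> K')\<close>, a field between \<open>k\<close> and \<open>K'\<close>. It suffices to find finitely many
  elements \<open>C\<close> of \<open>L\<close> with \<open>R \<inter> L \<subseteq> k[C]\<close>: then \<open>k[C]\<close> lies in \<open>K'\<close> and contains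
  \<open>R \<inter> K'\<close>, and its field of fractions is squeezed between \<open>Frac(R \<inter> K')\<close> and \<open>Frac L = L\<close>.

  The set \<open>C\<close> consists of the coefficients of a Groebner basis. Let \<open>x\<^sub>1, \<dots>, x\<^sub>n\<close> generate
  \<open>R\<close> over \<open>k\<close> and order the exponent vectors lexicographically, which gives a well-order
  compatible with addition. Call an exponent \<open>e\<close> reducible if the monomial \<open>x\<^sup>e\<close> is an
  \<open>L\<close>-linear combination of smaller monomials, and standard otherwise. By Dickson's lemma the
  reducible exponents all lie, componentwise, above finitely many of them, each of which comes
  with one relation; let \<open>C\<close> collect the coefficients of these relations. Rewriting with the
  relations shows that every monomial, hence every element of \<open>R\<close>, is a combination of standard
  monomials with coefficients in \<open>k[C]\<close>.

  The standard monomials are linearly independent over \<open>L\<close>, since the largest monomial of a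
  nontrivial relation would be reducible. So an element of \<open>R\<close> that lies in \<open>L = L x\<^sup>0\<close> has no
  other term in its expansion than the one at \<open>x\<^sup>0 = 1\<close>, whose coefficient is in \<open>k[C]\<close>.
\<close>

section \<open>Exponent vectors\<close>

text \<open>
  By induction on the length: a vector \<open>a # u\<close> of \<open>U\<close> whose head is large enough lies above one
  of finitely many vectors whose tails generate all tails occurring in \<open>U\<close>; for each of the
  finitely many remaining heads the slice of \<open>U\<close> with that head is finitely generated.
\<close>

lemma Dickson_finite_basis:
  fixes U :: "nat list set"
  assumes "\<And>u. u \<in> U \<Longrightarrow> length u = n"
  shows "\<exists>F. finite F \<and> F \<subseteq> U \<and> (\<forall>u\<in>U. \<exists>f\<in>F. list_all2 (\<le>) f u)"
  using assms
proof (induction n arbitrary: U)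
  case 0
  have "\<forall>u\<in>U. \<exists>f\<in>U. list_all2 (\<le>) f u" by (auto intro: list_all2_refl)
  moreover have "U \<subseteq> {[]}" using 0 by auto
  then have "finite U" using finite_subset by blast
  ultimately show ?case by blast
next
  case (Suc n)
  have "\<exists>G. finite G \<and> G \<subseteq> {u. \<exists>a. a # u \<in> U} \<and>
      (\<forall>u\<in>{u. \<exists>a. a # u \<in> U}. \<exists>g\<in>G. list_all2 (\<le>) g u)"
    by (rule Suc.IH) (use Suc.prems in force)
  then obtain G where G: "finite G" "\<And>g. g \<in> G \<Longrightarrow> \<exists>a. a # g \<in> U"
      "\<And>a u. a # u \<in> U \<Longrightarrow> \<exists>g\<in>G. list_all2 (\<le>) g u" by blast
  then obtain h where h: "\<And>g. g \<in> G \<Longrightarrow> h g # g \<in> U" by metis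
  obtain m where m: "\<And>g. g \<in> G \<Longrightarrow> h g \<le> m"
    using finite_nat_set_iff_bounded_le[of "h ` G"] G(1) by auto
  have "\<exists>B. finite B \<and> B \<subseteq> {u. b # u \<in> U} \<and>
      (\<forall>u\<in>{u. b # u \<in> U}. \<exists>g\<in>B. list_all2 (\<le>) g u)" for b
    by (rule Suc.IH) (use Suc.prems in force)
  then obtain B where B: "\<And>b. finite (B b)" "\<And>b u. u \<in> B b \<Longrightarrow> b # u \<in> U"
      "\<And>b u. b # u \<in> U \<Longrightarrow> \<exists>g\<in>B b. list_all2 (\<le>) g u" by (metis mem_Collect_eq subset_iff)
  define F where "F = (\<lambda>g. h g # g) ` G \<union> (\<Union>b<m. (#) b ` B b)"
  have "finite F" "F \<subseteq> U" using G(1) h B(1,2) by (auto simp: F_def)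
  moreover have "\<exists>f\<in>F. list_all2 (\<le>) f u" if u: "u \<in> U" for u
  proof -
    obtain b v where bv: "u = b # v" using Suc.prems[OF u] by (cases u) auto
    show ?thesis
    proof (cases "b < m")
      case True
      then obtain g where "g \<in> B b" "list_all2 (\<le>) g v" using B(3) u bv by blast
      then show ?thesis using True bv by (intro bexI[of _ "b # g"]) (auto simp: F_def)
    next
      case False
      obtain g where g: "g \<in> G" "list_all2 (\<le>) g v" using G(3) u bv by blast
      then have "h g \<le> b" using m False by fastforce
      then show ?thesis using g bv by (intro bexI[of _ "h g # g"]) (auto simp: F_def)
    qed
  qed
  ultimately show ?case by blast
qed

lemma list_all2_le_imp_add:
  fixes f u :: "nat list"
  assumes "list_all2 (\<le>) f u"
  shows "\<exists>d. length d = length u \<and> u = map2 (+) f d"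
  using assms
proof induction
  case (Cons x xs y ys)
  then obtain d where "length d = length ys" "ys = map2 (+) xs d" by blast
  then show ?case using Cons.hyps by (intro exI[of _ "(y - x) # d"]) auto
qed simp

lemma lex_add_mono:
  fixes d e c :: "nat list"
  assumes "(d, e) \<in> lex less_than" "length c = length e"
  shows "(map2 (+) d c, map2 (+) e c) \<in> lex less_than"
proof -
  have "length d = length e" using assms(1) by (simp add: lex_conv)
  then show ?thesis using assms
    by (induction d e arbitrary: c rule: list_induct2) (auto simp: length_Suc_conv)
qed

lemma lex_total:
  fixes d e :: "nat list"
  assumes "length d = length e"
  shows "d = e \<or> (d, e) \<in> lex less_than \<or> (e, d) \<in> lex less_than"
  using assms by (induction rule: list_induct2) auto

lemma lex_zero_least:
  fixes e :: "nat list"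
  shows "e = replicate (length e) 0 \<or> (replicate (length e) 0, e) \<in> lex less_than"
  by (induction e) auto

lemma lex_finite_has_max:
  fixes F :: "nat list set"
  assumes "finite F" "F \<noteq> {}" "\<And>e. e \<in> F \<Longrightarrow> length e = n"
  shows "\<exists>m\<in>F. \<forall>e\<in>F - {m}. (e, m) \<in> lex less_than"
proof -
  have tr: "trans (lex less_than)" by (rule lex_transI) (rule trans_less_than)
  have "transp_on F (\<lambda>d e. (d, e) \<in> lex less_than)"
    by (rule transp_onI) (use tr in \<open>blast dest: transD\<close>)
  moreover have "asymp_on F (\<lambda>d e. (d, e) \<in> lex less_than)"
    by (rule asymp_onI) (use wf_lex[OF wf_less_than] in \<open>blast dest: wf_asym\<close>)
  ultimately obtain m where "m \<in> F" "\<forall>e\<in>F. e \<noteq> m \<longrightarrow> (m, e) \<notin> lex less_than"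
    using Finite_Set.bex_max_element[OF assms(1)] assms(2) by blast
  then show ?thesis using lex_total assms(3) by (metis Diff_iff insertI1)
qed

section \<open>Linear combinations\<close>

text \<open>
  The coefficients form an arbitrary set, so that one notion covers spans over the field \<open>L\<close>,
  over the subring \<open>k[C]\<close>, and over the finite set of coefficients of a single relation.
\<close>

inductive_set lin_span :: "('a, 'b) ring_scheme \<Rightarrow> 'a set \<Rightarrow> 'a set \<Rightarrow> 'a set"
  for R (structure) and C M where
    zero: "\<zero> \<in> lin_span R C M"
  | step: "c \<in> C \<Longrightarrow> m \<in> M \<Longrightarrow> v \<in> lin_span R C M \<Longrightarrow> c \<otimes> m \<oplus> v \<in> lin_span R C M"

lemma lin_span_mono:
  assumes "v \<in> lin_span R C M" "C \<subseteq> D" "M \<subseteq> N"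
  shows "v \<in> lin_span R D N"
  using assms(1) by induction (use assms(2,3) in \<open>auto intro: lin_span.intros\<close>)

text \<open>
  Finiteness of \<open>D\<close> makes the set of all coefficients in finitely many relations finite;
  finiteness of \<open>N\<close> lets one speak of the largest monomial of a combination.
\<close>

lemma lin_span_finite:
  assumes "v \<in> lin_span R C M"
  shows "\<exists>D N. finite D \<and> D \<subseteq> C \<and> finite N \<and> N \<subseteq> M \<and> v \<in> lin_span R D N"
  using assms
proof induction
  case zero
  show ?case by (intro exI[of _ "{}"]) (auto intro: lin_span.zero)
next
  case (step c m v)
  then obtain D N where "finite D" "D \<subseteq> C" "finite N" "N \<subseteq> M" "v \<in> lin_span R D N" by blast
  moreover from this have "c \<otimes>\<^bsub>R\<^esub> m \<oplus>\<^bsub>R\<^esub> v \<in> lin_span R (insert c D) (insert m N)"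
    by (intro lin_span.step) (auto intro: lin_span_mono)
  ultimately show ?case using step.hyps
    by (intro exI[of _ "insert c D"] exI[of _ "insert m N"]) auto
qed

context cring
begin

lemma lin_span_closed:
  assumes "C \<subseteq> carrier R" "M \<subseteq> carrier R" "v \<in> lin_span R C M"
  shows "v \<in> carrier R"
  using assms(3) by induction (use assms(1,2) in auto)

lemma lin_span_incl:
  assumes "subring C R" "M \<subseteq> carrier R" "m \<in> M"
  shows "m \<in> lin_span R C M"
proof -
  have "\<one> \<otimes> m \<oplus> \<zero> \<in> lin_span R C M"
    using subringE(3)[OF assms(1)] assms(3) by (intro lin_span.intros)
  then show ?thesis using assms(2,3) by auto
qed

lemma lin_span_add:
  assumes "C \<subseteq> carrier R" "M \<subseteq> carrier R" "u \<in> lin_span R C M" "v \<in> lin_span R C M"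
  shows "u \<oplus> v \<in> lin_span R C M"
  using assms(3)
proof induction
  case zero
  then show ?case using lin_span_closed[OF assms(1,2,4)] assms(4) by simp
next
  case (step c m u)
  then have "c \<otimes> m \<oplus> u \<oplus> v = c \<otimes> m \<oplus> (u \<oplus> v)"
    using assms(1,2) lin_span_closed[OF assms(1,2)] assms(4) by (intro a_assoc) auto
  then show ?case using step by (simp add: lin_span.step)
qed

lemma lin_span_smult:
  assumes "subring C R" "M \<subseteq> carrier R" "c \<in> C" "v \<in> lin_span R C M"
  shows "c \<otimes> v \<in> lin_span R C M"
  using assms(4)
proof induction
  case zero
  then show ?case
    using subsetD[OF subringE(1)[OF assms(1)] assms(3)] by (simp add: lin_span.zero)
next
  case (step d m v)
  have C: "C \<subseteq> carrier R" using subringE(1)[OF assms(1)] .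
  have "c \<otimes> (d \<otimes> m \<oplus> v) = (c \<otimes> d) \<otimes> m \<oplus> c \<otimes> v"
    using step.hyps assms(2,3) C lin_span_closed[OF C assms(2)]
    by (subst r_distr) (auto simp: m_assoc subset_iff)
  then show ?case
    using step subringE(6)[OF assms(1) assms(3)] by (simp add: lin_span.step)
qed

lemma lin_span_subset:
  assumes "subring C R" "N \<subseteq> carrier R" "M \<subseteq> lin_span R C N" "v \<in> lin_span R C M"
  shows "v \<in> lin_span R C N"
  using assms(4)
proof induction
  case (step c m v)
  then show ?case
    using assms lin_span_smult lin_span_add subringE(1)[OF assms(1)] by (meson subsetD)
qed (rule lin_span.zero)

lemma lin_span_mult:
  assumes "C \<subseteq> carrier R" "M \<subseteq> carrier R" "x \<in> carrier R" "v \<in> lin_span R C M"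
  shows "v \<otimes> x \<in> lin_span R C ((\<lambda>m. m \<otimes> x) ` M)"
  using assms(4)
proof induction
  case zero
  then show ?case using assms(3) by (simp add: lin_span.zero)
next
  case (step c m v)
  have "(c \<otimes> m \<oplus> v) \<otimes> x = c \<otimes> (m \<otimes> x) \<oplus> v \<otimes> x"
    using step.hyps assms(1-3) lin_span_closed[OF assms(1,2)]
    by (subst l_distr) (auto simp: m_assoc subset_iff)
  then show ?case using step by (auto intro: lin_span.step)
qed

lemma lin_span_insert:
  assumes "subring C R" "M \<subseteq> carrier R" "m \<in> carrier R" "v \<in> lin_span R C (insert m M)"
  shows "\<exists>c\<in>C. \<exists>w\<in>lin_span R C M. v = c \<otimes> m \<oplus> w"
  using assms(4)
proof induction
  case zero
  have "\<zero> = \<zero> \<otimes> m \<oplus> \<zero>" using assms(3) by simp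
  then show ?case using subringE(2)[OF assms(1)] lin_span.zero by metis
next
  case (step d y v)
  have C: "C \<subseteq> carrier R" using subringE(1)[OF assms(1)] .
  from step obtain c w where cw: "c \<in> C" "w \<in> lin_span R C M" "v = c \<otimes> m \<oplus> w" by blast
  have w: "w \<in> carrier R" using lin_span_closed[OF C assms(2) cw(2)] .
  show ?case
  proof (cases "y = m")
    case True
    have "d \<otimes> y \<oplus> v = (d \<oplus> c) \<otimes> m \<oplus> w"
      using True cw C step.hyps(1) assms(3) w by (auto simp: l_distr a_assoc subset_iff)
    then show ?thesis using subringE(7)[OF assms(1) step.hyps(1) cw(1)] cw(2) by blast
  next
    case False
    then have y: "y \<in> M" using step.hyps by blast
    have "d \<otimes> y \<oplus> v = c \<otimes> m \<oplus> (d \<otimes> y \<oplus> w)"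
      using cw C step.hyps(1) assms(2,3) w y by (auto simp: a_lcomm subset_iff)
    then show ?thesis using lin_span.step[OF step.hyps(1) y cw(2)] cw(1) by blast
  qed
qed

text \<open>
  Only closure under products needs an argument: expand the second factor, then the first, and
  multiply the vectors of \<open>M\<close> pairwise.
\<close>

lemma lin_span_is_subring:
  assumes C: "subring C R" and M: "M \<subseteq> carrier R" "\<one> \<in> M"
    and mult: "\<And>x y. x \<in> M \<Longrightarrow> y \<in> M \<Longrightarrow> x \<otimes> y \<in> M"
  shows "subring (lin_span R C M) R"
proof -
  note CR = subringE(1)[OF C]
  note cl = lin_span_closed[OF CR M(1)]
  have prod: "u \<otimes> v \<in> lin_span R C M"
    if u: "u \<in> lin_span R C M" and v: "v \<in> lin_span R C M" for u v
    using v
  proof induction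
    case zero
    then show ?case using cl[OF u] by (simp add: lin_span.zero)
  next
    case (step c m v)
    have m: "m \<in> carrier R" using step.hyps M by blast
    have "u \<otimes> m \<in> lin_span R C M"
      using lin_span_mult[OF CR M(1) m u] mult step.hyps(2) by (auto intro: lin_span_mono)
    then have "c \<otimes> (u \<otimes> m) \<oplus> u \<otimes> v \<in> lin_span R C M"
      using step lin_span_smult[OF C M(1)] lin_span_add[OF CR M(1)] by blast
    moreover have "u \<otimes> (c \<otimes> m \<oplus> v) = c \<otimes> (u \<otimes> m) \<oplus> u \<otimes> v"
      using step.hyps CR m cl u by (subst r_distr) (auto simp: m_lcomm)
    ultimately show ?case by simp
  qed
  have neg: "\<ominus> v \<in> lin_span R C M" if v: "v \<in> lin_span R C M" for v
  proof -
    have "\<ominus> \<one> \<otimes> v \<in> lin_span R C M"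
      using lin_span_smult[OF C M(1) _ v] subringE(3,5)[OF C] by blast
    then show ?thesis using cl[OF v] by (simp add: l_minus)
  qed
  show ?thesis
    by (rule subringI)
      (use cl prod neg lin_span_incl[OF C M] lin_span_add[OF CR M(1)] in auto)
qed

end

section \<open>Monomials and reducible exponents\<close>

fun monomial :: "('a, 'b) ring_scheme \<Rightarrow> 'a list \<Rightarrow> nat list \<Rightarrow> 'a" where
  "monomial R (x # xs) (e # es) = x [^]\<^bsub>R\<^esub> e \<otimes>\<^bsub>R\<^esub> monomial R xs es"
| "monomial R _ _ = \<one>\<^bsub>R\<^esub>"

text \<open>
  The lexicographic order relates only lists of equal length, so all exponents below \<open>e\<close>
  are again exponent vectors for \<open>xs\<close>.
\<close>

definition reducible :: "('a, 'b) ring_scheme \<Rightarrow> 'a set \<Rightarrow> 'a list \<Rightarrow> nat list set" where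
  "reducible R L xs = {e. length e = length xs \<and>
     monomial R xs e \<in> lin_span R L (monomial R xs ` {d. (d, e) \<in> lex less_than})}"

context cring
begin

lemma monomial_closed:
  "set xs \<subseteq> carrier R \<Longrightarrow> monomial R xs e \<in> carrier R"
  by (induction R\<equiv>R xs e rule: monomial.induct) auto

lemma monomial_zero: "set xs \<subseteq> carrier R \<Longrightarrow> monomial R xs (replicate n 0) = \<one>"
proof (induction xs arbitrary: n)
  case (Cons x xs)
  then show ?case by (cases n) auto
qed simp

lemma monomial_add:
  assumes "length d = length xs" "length e = length xs" "set xs \<subseteq> carrier R"
  shows "monomial R xs (map2 (+) d e) = monomial R xs d \<otimes> monomial R xs e"
  using assms
proof (induction xs arbitrary: d e)
  case (Cons x xs)
  then obtain a as b bs where de: "d = a # as" "e = b # bs"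
      "length as = length xs" "length bs = length xs"
    by (metis length_Suc_conv)
  then show ?case using Cons monomial_closed[of xs as] monomial_closed[of xs bs]
    by (simp add: nat_pow_mult[symmetric] m_ac)
qed simp

lemma generator_is_monomial:
  assumes "x \<in> set xs" "set xs \<subseteq> carrier R"
  shows "\<exists>e. length e = length xs \<and> monomial R xs e = x"
  using assms
proof (induction xs)
  case (Cons y xs)
  show ?case
  proof (cases "x = y")
    case True
    then show ?thesis using Cons.prems monomial_zero[of xs "length xs"]
      by (intro exI[of _ "1 # replicate (length xs) 0"]) simp
  next
    case False
    then obtain e where "length e = length xs" "monomial R xs e = x" using Cons by auto
    then show ?thesis using Cons.prems by (intro exI[of _ "0 # e"]) auto
  qed
qed simp

text \<open>
  The span of the monomials is itself a subring, since monomials multiply by adding exponents,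
  and it contains \<open>k\<close> and the generators.
\<close>

lemma generate_ring_subset_monomial_span:
  assumes C: "subring C R" and "k \<subseteq> C" and xs: "set xs \<subseteq> carrier R"
  shows "generate_ring R (k \<union> set xs) \<subseteq>
    lin_span R C (monomial R xs ` {e. length e = length xs})" (is "_ \<subseteq> ?T")
proof (rule generate_ring_min_subring1)
  let ?M = "monomial R xs ` {e. length e = length xs}"
  have M: "?M \<subseteq> carrier R" using monomial_closed[OF xs] by auto
  have one: "\<one> \<in> ?M"
    using monomial_zero[OF xs, of "length xs"]
    by (metis (mono_tags) image_eqI length_replicate mem_Collect_eq)
  show "subring ?T R"
  proof (rule lin_span_is_subring[OF C M one])
    fix x y assume "x \<in> ?M" "y \<in> ?M"
    then obtain d e where "x = monomial R xs d" "y = monomial R xs e"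
        "length d = length xs" "length e = length xs" by auto
    then show "x \<otimes> y \<in> ?M" using monomial_add[OF _ _ xs, of d e]
      by (intro image_eqI[of _ _ "map2 (+) d e"]) auto
  qed
  show "k \<union> set xs \<subseteq> carrier R" using assms subringE(1)[OF C] by auto
  have "c \<in> ?T" if "c \<in> C" for c
    using lin_span_smult[OF C M that lin_span_incl[OF C M one]] that subringE(1)[OF C] by auto
  moreover have "x \<in> ?T" if "x \<in> set xs" for x
    using generator_is_monomial[OF that xs] lin_span_incl[OF C M] by blast
  ultimately show "k \<union> set xs \<subseteq> ?T" using assms(2) by blast
qed

text \<open>
  Division with remainder by the relations attached to a basis \<open>F\<close> of \<open>U\<close>, to be applied with
  the reducible exponents as \<open>U\<close>: a multiple of the relation at \<open>f \<in> F\<close> rewrites the monomial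
  at \<open>f + d\<close> into smaller ones, and this terminates since the lexicographic order is
  well-founded. The coefficients that occur are generated by those of the relations.
\<close>

lemma monomial_in_standard_span:
  assumes A: "subring A R" and xs: "set xs \<subseteq> carrier R"
    and rel: "\<And>f. f \<in> F \<Longrightarrow>
      monomial R xs f \<in> lin_span R A (monomial R xs ` {d. (d, f) \<in> lex less_than})"
    and F: "\<And>f. f \<in> F \<Longrightarrow> length f = length xs"
    and basis: "\<And>e. e \<in> U \<Longrightarrow> \<exists>f\<in>F. list_all2 (\<le>) f e"
    and e: "length e = length xs"
  shows "monomial R xs e \<in> lin_span R A (monomial R xs ` ({e. length e = length xs} - U))"
  using e
proof (induction e rule: wf_induct_rule[OF wf_lex[OF wf_less_than]])
  case (1 e)
  let ?N = "monomial R xs ` ({e. length e = length xs} - U)"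
  have N: "?N \<subseteq> carrier R" using monomial_closed[OF xs] by auto
  show ?case
  proof (cases "e \<in> U")
    case False
    then show ?thesis using 1 lin_span_incl[OF A N] by auto
  next
    case True
    then obtain f where f: "f \<in> F" "list_all2 (\<le>) f e" using basis by blast
    then obtain d where d: "length d = length xs" "e = map2 (+) f d"
      using list_all2_le_imp_add 1(2) by metis
    let ?B = "monomial R xs ` {g. (g, f) \<in> lex less_than}"
    have "monomial R xs e = monomial R xs f \<otimes> monomial R xs d"
      using monomial_add[OF F[OF f(1)] d(1) xs] d(2) by simp
    moreover have "monomial R xs f \<otimes> monomial R xs d
        \<in> lin_span R A ((\<lambda>m. m \<otimes> monomial R xs d) ` ?B)"
      using monomial_closed[OF xs] rel[OF f(1)]
      by (intro lin_span_mult[OF subringE(1)[OF A]]) auto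
    moreover have "(\<lambda>m. m \<otimes> monomial R xs d) ` ?B \<subseteq> lin_span R A ?N"
    proof clarify
      fix g assume g: "(g, f) \<in> lex less_than"
      then have len: "length g = length xs" using F[OF f(1)] by (simp add: lex_conv)
      have "(map2 (+) g d, e) \<in> lex less_than"
        using lex_add_mono[OF g] d F[OF f(1)] by simp
      then have "monomial R xs (map2 (+) g d) \<in> lin_span R A ?N"
        using 1(1) len d(1) by simp
      then show "monomial R xs g \<otimes> monomial R xs d \<in> lin_span R A ?N"
        using monomial_add[OF len d(1) xs] by simp
    qed
    ultimately show ?thesis using lin_span_subset[OF A N] by metis
  qed
qed

end

section \<open>Intersecting a finitely generated algebra with a subfield\<close>

text \<open>
  Linear independence of standard monomials, in the form needed: in a scalar \<open>v \<in> L\<close> that is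
  a combination of standard monomials, the largest monomial \<open>x\<^sup>m\<close> with \<open>m \<noteq> 0\<close> has
  coefficient zero, for otherwise dividing by this coefficient would express \<open>x\<^sup>m\<close> through
  smaller monomials and \<open>v \<cdot> x\<^sup>0\<close>. At most the constant term is left, and it equals \<open>v\<close>.
\<close>

lemma (in field) scalar_in_standard_span:
  assumes L: "subfield L R" and A: "subring A R" "A \<subseteq> L" and xs: "set xs \<subseteq> carrier R"
    and "finite F" "F \<subseteq> {e. length e = length xs} - reducible R L xs"
    and "v \<in> lin_span R A (monomial R xs ` F)" "v \<in> L"
  shows "v \<in> A"
  using assms(5-)
proof (induction "card F" arbitrary: F)
  case 0
  then have "v = \<zero>" by (auto elim: lin_span.cases)
  then show ?case using subringE(2)[OF A(1)] by simp
next
  case (Suc c)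
  note LR = subfieldE(1)[OF L]
  note LC = subfieldE(3)[OF L]
  have len: "length e = length xs" if "e \<in> F" for e using Suc.prems(2) that by blast
  have "F \<noteq> {}" using Suc.hyps(2) by auto
  then obtain m where m: "m \<in> F" "\<And>e. e \<in> F - {m} \<Longrightarrow> (e, m) \<in> lex less_than"
    using lex_finite_has_max[OF Suc.prems(1) _ len] by blast
  let ?N = "monomial R xs ` (F - {m})"
  let ?B = "monomial R xs ` {d. (d, m) \<in> lex less_than}"
  let ?m = "monomial R xs m"
  have N: "?N \<subseteq> carrier R" and B: "?B \<subseteq> carrier R" and mR: "?m \<in> carrier R"
    using monomial_closed[OF xs] by auto
  have "monomial R xs ` F = insert ?m ?N" using m(1) by auto
  then obtain a w where aw: "a \<in> A" "w \<in> lin_span R A ?N" "v = a \<otimes> ?m \<oplus> w"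
    using lin_span_insert[OF A(1) N mR] Suc.prems(3) by metis
  have aR: "a \<in> carrier R" and vR: "v \<in> carrier R" and wR: "w \<in> carrier R"
    using aw(1) A(2) LC Suc.prems(4) lin_span_closed[OF subringE(1)[OF A(1)] N aw(2)] by auto
  show ?case
  proof (cases "m = replicate (length xs) 0")
    case True
    have "F - {m} = {}"
    proof (rule ccontr)
      assume "F - {m} \<noteq> {}"
      then obtain e where "e \<in> F" "e \<noteq> m" by blast
      then have "(e, m) \<in> lex less_than" "(m, e) \<in> lex less_than"
        using m(2) lex_zero_least[of e] True len by auto
      then show False using wf_asym[OF wf_lex[OF wf_less_than]] by blast
    qed
    then have "w = \<zero>" using aw(2) by (auto elim: lin_span.cases)
    then have "v = a" using aw(3) True monomial_zero[OF xs] aR by simp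
    then show ?thesis using aw(1) by simp
  next
    case False
    have "a = \<zero>"
    proof (rule ccontr)
      assume "a \<noteq> \<zero>"
      then have a: "a \<in> L - {\<zero>}" using aw(1) A(2) by blast
      note inv = subfield_m_inv[OF L a]
      have iR: "inv a \<in> carrier R" using inv(1) LC by blast
      have "(replicate (length xs) 0, m) \<in> lex less_than"
        using lex_zero_least[of m] False len[OF m(1)] by simp
      then have one: "\<one> \<in> ?B"
        using monomial_zero[OF xs, of "length xs"] by (metis image_eqI mem_Collect_eq)
      then have v: "v \<in> lin_span R L ?B"
        using lin_span_smult[OF LR B Suc.prems(4) lin_span_incl[OF LR B one]] vR by simp
      have w: "w \<in> lin_span R L ?B"
        by (rule lin_span_mono[OF aw(2) A(2)]) (use m(2) in blast)
      have "\<ominus> \<one> \<in> L" using subringE(3,5)[OF LR] by blast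
      then have "\<ominus> \<one> \<otimes> w \<in> lin_span R L ?B" using lin_span_smult[OF LR B _ w] by blast
      then have "inv a \<otimes> (v \<oplus> \<ominus> \<one> \<otimes> w) \<in> lin_span R L ?B"
        using lin_span_smult[OF LR B] lin_span_add[OF LC B v] inv(1) by blast
      moreover have "v \<oplus> \<ominus> \<one> \<otimes> w = a \<otimes> ?m"
        using aw(3) aR mR wR by (simp add: l_minus a_assoc r_neg)
      moreover have "inv a \<otimes> (a \<otimes> ?m) = ?m"
        using inv(3) iR aR mR by (simp add: m_assoc[symmetric])
      ultimately have "?m \<in> lin_span R L ?B" by simp
      then have "m \<in> reducible R L xs" using len[OF m(1)] by (simp add: reducible_def)
      then show False using m(1) Suc.prems(2) by blast
    qed
    then have "v = w" using aw(3) mR wR by simp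
    moreover have "c = card (F - {m})" using Suc.hyps(2) Suc.prems(1) m(1) by simp
    ultimately show ?thesis
      using Suc.hyps(1)[of "F - {m}"] Suc.prems(1,2,4) aw(2) by blast
  qed
qed

text \<open>
  The intersection of a finitely generated algebra with a subfield need not be finitely generated
  itself (Hilbert's fourteenth problem), but it is contained in a finitely generated subalgebra of
  that subfield.
\<close>

lemma (in field) intersection_subset_finitely_generated:
  assumes L: "subfield L R" and k: "k \<subseteq> L" and S: "finite S" "S \<subseteq> carrier R"
  shows "\<exists>C. finite C \<and> C \<subseteq> L \<and>
    generate_ring R (k \<union> S) \<inter> L \<subseteq> generate_ring R (k \<union> C)"
proof -
  obtain xs where "set xs = S" using finite_list[OF S(1)] by blast
  then have xs: "set xs \<subseteq> carrier R" and gen: "k \<union> S = k \<union> set xs" using S by auto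
  note LR = subfieldE(1)[OF L]
  note LC = subfieldE(3)[OF L]
  let ?U = "reducible R L xs"
  let ?below = "\<lambda>f. monomial R xs ` {d. (d, f) \<in> lex less_than}"
  have "\<exists>F. finite F \<and> F \<subseteq> ?U \<and> (\<forall>u\<in>?U. \<exists>f\<in>F. list_all2 (\<le>) f u)"
    by (rule Dickson_finite_basis) (simp add: reducible_def)
  then obtain F where F: "finite F" "F \<subseteq> ?U"
      and basis: "\<And>u. u \<in> ?U \<Longrightarrow> \<exists>f\<in>F. list_all2 (\<le>) f u" by blast
  \<comment> \<open>The sets \<open>D f\<close> hold the coefficients of one relation for each basis exponent \<open>f\<close>.\<close>
  have "\<exists>D. finite D \<and> D \<subseteq> L \<and> monomial R xs f \<in> lin_span R D (?below f)" if f: "f \<in> F" for f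
  proof -
    have "monomial R xs f \<in> lin_span R L (?below f)" using F(2) f by (auto simp: reducible_def)
    from lin_span_finite[OF this] obtain D N where D: "finite D" "D \<subseteq> L"
        and N: "N \<subseteq> ?below f" "monomial R xs f \<in> lin_span R D N" by blast
    have "monomial R xs f \<in> lin_span R D (?below f)"
      by (rule lin_span_mono[OF N(2) order_refl N(1)])
    then show ?thesis using D by blast
  qed
  then obtain D where D: "\<And>f. f \<in> F \<Longrightarrow> finite (D f)" "\<And>f. f \<in> F \<Longrightarrow> D f \<subseteq> L"
      "\<And>f. f \<in> F \<Longrightarrow> monomial R xs f \<in> lin_span R (D f) (?below f)" by metis
  define C where "C = (\<Union>f\<in>F. D f)"
  let ?A = "generate_ring R (k \<union> C)"
  have C: "finite C" "C \<subseteq> L" using F(1) D(1,2) by (auto simp: C_def)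
  then have "k \<union> C \<subseteq> carrier R" using k LC by blast
  note A = generate_ring_is_subring[OF this] and AL = generate_ring_min_subring1[OF this LR]
  have AL: "?A \<subseteq> L" using AL k C(2) by blast
  have kA: "k \<subseteq> ?A" by (auto intro: generate_ring.incl)
  have rel: "monomial R xs f \<in> lin_span R ?A (?below f)" if f: "f \<in> F" for f
    by (rule lin_span_mono[OF D(3)[OF f]]) (use f in \<open>auto simp: C_def intro: generate_ring.incl\<close>)
  let ?St = "{e. length e = length xs} - ?U"
  have St: "monomial R xs ` ?St \<subseteq> carrier R" using monomial_closed[OF xs] by auto
  have mon: "monomial R xs ` {e. length e = length xs} \<subseteq> lin_span R ?A (monomial R xs ` ?St)"
  proof clarify
    fix e :: "nat list" assume e: "length e = length xs"
    have len: "length f = length xs" if "f \<in> F" for f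
      using that F(2) by (auto simp: reducible_def)
    show "monomial R xs e \<in> lin_span R ?A (monomial R xs ` ?St)"
      by (rule monomial_in_standard_span[OF A xs, where F = F]) (fact rel len basis e)+
  qed
  have span: "generate_ring R (k \<union> S) \<subseteq> lin_span R ?A (monomial R xs ` ?St)"
    unfolding gen
    by (rule subset_trans[OF generate_ring_subset_monomial_span[OF A kA xs]])
      (rule subsetI, rule lin_span_subset[OF A St mon])
  have "v \<in> ?A" if v: "v \<in> generate_ring R (k \<union> S)" "v \<in> L" for v
  proof -
    obtain B N where B: "B \<subseteq> ?A" and N: "finite N" "N \<subseteq> monomial R xs ` ?St"
        and vN: "v \<in> lin_span R B N"
      using lin_span_finite[OF subsetD[OF span v(1)]] by blast
    obtain G where G: "G \<subseteq> ?St" "finite G" "N = monomial R xs ` G"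
      using finite_subset_image[OF N] by blast
    have "v \<in> lin_span R ?A (monomial R xs ` G)"
      using lin_span_mono[OF vN B order_refl] G(3) by simp
    then show ?thesis using scalar_in_standard_span[OF L A AL xs G(2,1)] v(2) by simp
  qed
  then show ?thesis using C by blast
qed

theorem theorem1p1:
  fixes K :: "('a, 'b) ring_scheme" and k R K' :: "'a set"
  assumes "field K"
    and "subfield k K"
    and "subdomain R K"
    and "finite_type k R K"
    and "carrier K = Frac K R"
    and "subfield K' K"
    and "k \<subseteq> K'"
  shows "\<exists>R'. finite_type k R' K \<and> R' \<subseteq> K' \<and> R \<inter> K' \<subseteq> R' \<and>
              Frac K R' = Frac K (R \<inter> K')"
proof -
  interpret K: field K by fact
  obtain S where S: "finite S" "S \<subseteq> R" "R = generate_ring K (k \<union> S)" and kR: "k \<subseteq> R"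
      and R: "subring R K"
    using assms(4) by (auto simp: finite_type_def sub_k_algebra_def)
  note RC = subringE(1)[OF R]
  have A: "subring (R \<inter> K') K"
    using K.subring_inter R subfieldE(1)[OF assms(6)] by blast
  then have AC: "R \<inter> K' \<subseteq> carrier K" by (rule subringE(1))
  define L where "L = generate_field K (R \<inter> K')"
  have FL: "Frac K (R \<inter> K') = L" unfolding L_def by (rule K.Frac_eq_generate_field[OF A])
  have L: "subfield L K" unfolding L_def by (rule K.generate_field_is_subfield[OF AC])
  have LK': "L \<subseteq> K'" unfolding L_def
    using K.generate_field_min_subfield1[OF AC assms(6)] by blast
  have AL: "R \<inter> K' \<subseteq> L" unfolding L_def by (auto intro: generate_field.incl)
  have kL: "k \<subseteq> L" using AL kR assms(7) by blast
  obtain C where C: "finite C" "C \<subseteq> L" "R \<inter> L \<subseteq> generate_ring K (k \<union> C)"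
    using K.intersection_subset_finitely_generated[OF L kL S(1)] S(2,3) RC by blast
  let ?R' = "generate_ring K (k \<union> C)"
  have kC: "k \<union> C \<subseteq> carrier K" using kL C(2) subfieldE(3)[OF L] by blast
  have R': "subring ?R' K" by (rule K.generate_ring_is_subring[OF kC])
  have R'L: "?R' \<subseteq> L"
    using K.generate_ring_min_subring1[OF kC subfieldE(1)[OF L]] kL C(2) by blast
  have AR': "R \<inter> K' \<subseteq> ?R'" using AL C(3) by blast
  have "finite_type k ?R' K"
    using R' C(1) by (auto simp: finite_type_def sub_k_algebra_def intro: generate_ring.incl)
  moreover have "Frac K ?R' = Frac K (R \<inter> K')"
  proof
    have "Frac K ?R' = generate_field K ?R'" by (rule K.Frac_eq_generate_field[OF R'])
    also have "\<dots> \<subseteq> L"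
      using K.generate_field_min_subfield1[OF subringE(1)[OF R'] L R'L] .
    finally show "Frac K ?R' \<subseteq> Frac K (R \<inter> K')" using FL by simp
    show "Frac K (R \<inter> K') \<subseteq> Frac K ?R'" using AR' unfolding Frac_def by blast
  qed
  ultimately show ?thesis using R'L LK' AR' by blast
qed

end
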